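(* Suppose that a language $L$ is recognized by an $n$-dimensional MO-1gQFA with cut-point isolated by $\delta$. Then $L$ can be recognized by a DFA with $d$ states, where $d$ satisfies $$d\leq\left(1+\frac{\sqrt{n}}{\delta}\right)^{2n^2}.$$
   Context: A trace-preserving quantum operation on a finite-dimensional complex Hilbert space $\mathcal{H}$ is a linear map $\mathcal{E}$ on the linear operators on $\mathcal{H}$ of the form $\mathcal{E}(\rho)=\sum_k E_k\rho E_k^\dagger$ with $\sum_k E_k^\dagger E_k=I$. A density operator is a positive semi-definite operator of trace $1$. An $n$-dimensional MO-1gQFA is a tuple $\mathcal{A}=(\mathcal{H},\Sigma,\rho_0,\{\mathcal{E}_\sigma\}_{\sigma\in\Sigma},P_{acc})$, where $\mathcal{H}$ is a complex Hilbert space of finite dimension $n$, $\Sigma$ is a finite alphabet, $\rho_0$ is a density operator on $\mathcal{H}$, each $\mathcal{E}_\sigma$ is a trace-preserving quantum operation on $\mathcal{H}$, and $P_{acc}$ is an (orthogonal) projector on a subspace of $\mathcal{H}$. It accepts $x=x_1x_2\cdots x_m\in\Sigma^*$ with probability $$\mathcal{P}_{\mathcal{A}}(x)=\mathrm{Tr}\big(P_{acc}\,\mathcal{E}_{x_m}\circ\cdots\circ\mathcal{E}_{x_2}\circ\mathcal{E}_{x_1}(\rho_0)\big).$$ A language $L\subseteq\Sigma^*$ is recognized by $\mathcal{A}$ with cut-point isolated by $\delta$, where $\delta\in(0,\frac12]$, if there is $\lambda\in(0,1]$ such that $\mathcal{P}_{\mathcal{A}}(x)>\lambda$ for all $x\in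 L$, $\mathcal{P}_{\mathcal{A}}(x)\le\lambda$ for all $x\notin L$, and $|\mathcal{P}_{\mathcal{A}}(x)-\lambda|\ge\delta$ for all $x\in\Sigma^*$. A DFA is a deterministic finite automaton with a total transition function. *)

theory Defs
  imports "HOL-Analysis.Analysis"
begin

text \<open>The Hilbert space of dimension \<open>CARD('n)\<close> is \<open>complex ^ 'n\<close>, and linear operators on it
  are the matrices \<open>complex ^ 'n ^ 'n\<close>. The library's \<open>inner\<close> on \<open>complex ^ 'n\<close> is only the real
  part of the Hermitian inner product, and its \<open>adjoint\<close> is taken with respect to that real
  inner product, so both complex notions are introduced here.\<close>

definition cinner :: "complex ^ 'n \<Rightarrow> complex ^ 'n \<Rightarrow> complex" where
  "cinner v w = (\<Sum>i\<in>UNIV. cnj (v $ i) * w $ i)"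

definition dagger :: "complex ^ 'n ^ 'n \<Rightarrow> complex ^ 'n ^ 'n" where
  "dagger A = (\<chi> i j. cnj (A $ j $ i))"

definition pos_semidef :: "complex ^ 'n ^ 'n \<Rightarrow> bool" where
  "pos_semidef A \<longleftrightarrow> dagger A = A \<and> (\<forall>v. 0 \<le> Re (cinner v (A *v v)))"

definition density_operator :: "complex ^ 'n ^ 'n \<Rightarrow> bool" where
  "density_operator \<rho> \<longleftrightarrow> pos_semidef \<rho> \<and> trace \<rho> = 1"

text \<open>Here \<open>vec.subspace\<close> means complex subspace.\<close>

definition projector :: "complex ^ 'n ^ 'n \<Rightarrow> bool" where
  "projector P \<longleftrightarrow>
    (\<exists>S. vec.subspace S \<and> (\<forall>v. P *v v \<in> S \<and> (\<forall>w\<in>S. cinner w (v - P *v v) = 0)))"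

definition quantum_operation :: "(complex ^ 'n ^ 'n \<Rightarrow> complex ^ 'n ^ 'n) \<Rightarrow> bool" where
  "quantum_operation \<E> \<longleftrightarrow>
    (\<exists>(m::nat) E. (\<forall>\<rho>. \<E> \<rho> = (\<Sum>k<m. E k ** \<rho> ** dagger (E k))) \<and>
                  (\<Sum>k<m. dagger (E k) ** E k) = mat 1)"

record ('n::finite, 'a) mo1gqfa =
  alphabet :: "'a set"
  init_op :: "complex ^ 'n ^ 'n"
  letter_op :: "'a \<Rightarrow> complex ^ 'n ^ 'n \<Rightarrow> complex ^ 'n ^ 'n"
  acc_proj :: "complex ^ 'n ^ 'n"

definition mo1gqfa :: "('n::finite, 'a) mo1gqfa \<Rightarrow> bool" where
  "mo1gqfa A \<longleftrightarrow>
    finite (alphabet A) \<and> density_operator (init_op A) \<and>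
    (\<forall>a\<in>alphabet A. quantum_operation (letter_op A a)) \<and> projector (acc_proj A)"

text \<open>For an automaton satisfying \<open>mo1gqfa\<close> and a word over its alphabet the trace below is a
  real number, so \<open>Re\<close> is merely the coercion to \<open>real\<close>.\<close>

definition acc_prob :: "('n::finite, 'a) mo1gqfa \<Rightarrow> 'a list \<Rightarrow> real" where
  "acc_prob A x = Re (trace (acc_proj A ** fold (letter_op A) x (init_op A)))"

definition recognizes_isolated ::
    "('n::finite, 'a) mo1gqfa \<Rightarrow> 'a list set \<Rightarrow> real \<Rightarrow> bool" where
  "recognizes_isolated A L \<delta> \<longleftrightarrow>
    L \<subseteq> lists (alphabet A) \<and> 0 < \<delta> \<and> \<delta> \<le> 1/2 \<and>
    (\<exists>c. 0 < c \<and> c \<le> 1 \<and>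
      (\<forall>x\<in>L. acc_prob A x > c) \<and>
      (\<forall>x\<in>lists (alphabet A) - L. acc_prob A x \<le> c) \<and>
      (\<forall>x\<in>lists (alphabet A). \<bar>acc_prob A x - c\<bar> \<ge> \<delta>))"

record ('q, 'a) dfa =
  dfa_states :: "'q set"
  dfa_alphabet :: "'a set"
  dfa_start :: 'q
  dfa_step :: "'q \<Rightarrow> 'a \<Rightarrow> 'q"
  dfa_final :: "'q set"

definition dfa :: "('q, 'a) dfa \<Rightarrow> bool" where
  "dfa M \<longleftrightarrow>
    finite (dfa_states M) \<and> finite (dfa_alphabet M) \<and>
    dfa_start M \<in> dfa_states M \<and> dfa_final M \<subseteq> dfa_states M \<and>
    (\<forall>q\<in>dfa_states M. \<forall>a\<in>dfa_alphabet M. dfa_step M q a \<in> dfa_states M)"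

definition dfa_language :: "('q, 'a) dfa \<Rightarrow> 'a list set" where
  "dfa_language M =
    {x \<in> lists (dfa_alphabet M). foldl (dfa_step M) (dfa_start M) x \<in> dfa_final M}"

end

theory Submission
  imports Defs
begin

text \<open>In the Heisenberg picture, reading a word \<open>z\<close> and then measuring is the functional
  \<open>\<rho> \<mapsto> Tr(Y \<rho>)\<close> with \<open>Y\<close> of operator norm at most 1, so by Cauchy--Schwarz it is
  \<open>\<surd>n\<close>-Lipschitz in the Frobenius norm (the \<open>norm\<close> of the type of matrices). If \<open>z\<close> distinguishes
  two words, their acceptance probabilities differ by at least \<open>2\<delta>\<close>, hence the density operators
  reached lie at Frobenius distance at least \<open>2\<delta>/\<surd>n\<close>. These operators lie in the unit ball of a
  real space of dimension \<open>2n\<^sup>2\<close>, so comparing volumes bounds the number of left quotients of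
  the language, which are the states of its minimal automaton.\<close>

section \<open>The Hermitian inner product, adjoints and sums of matrices\<close>

lemma norm_vec_sq: "(norm v)\<^sup>2 = (\<Sum>i\<in>UNIV. (norm (v $ i))\<^sup>2)"
  by (simp add: norm_vec_def L2_set_def sum_nonneg)

lemma cinner_self: "cinner v v = of_real ((norm v)\<^sup>2)"
  unfolding cinner_def norm_vec_sq of_real_sum
  by (intro sum.cong refl) (simp add: complex_norm_square mult.commute del: of_real_power)

lemma norm_cinner_le: "norm (cinner v w) \<le> norm v * norm w"
proof -
  have "norm (cinner v w) \<le> (\<Sum>i\<in>UNIV. \<bar>norm (v $ i)\<bar> * \<bar>norm (w $ i)\<bar>)"
    unfolding cinner_def by (rule order_trans[OF norm_sum]) (simp add: norm_mult)
  also have "\<dots> \<le> norm v * norm w"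
    unfolding norm_vec_def by (rule L2_set_mult_ineq)
  finally show ?thesis .
qed

lemma cinner_add_left: "cinner (v + u) w = cinner v w + cinner u w"
  by (simp add: cinner_def sum.distrib algebra_simps)

lemma cinner_add_right: "cinner v (w + u) = cinner v w + cinner v u"
  by (simp add: cinner_def sum.distrib algebra_simps)

lemma cinner_diff_right: "cinner v (w - u) = cinner v w - cinner v u"
  by (simp add: cinner_def sum_subtractf algebra_simps)

lemma cinner_zero_right [simp]: "cinner v 0 = 0"
  by (simp add: cinner_def)

lemma cinner_sum_right: "cinner v (sum f S) = (\<Sum>k\<in>S. cinner v (f k))"
  by (induction S rule: infinite_finite_induct) (auto simp: cinner_add_right)

lemma cinner_axis_left: "cinner (axis i a) w = cnj a * w $ i"
proof -
  have "cinner (axis i a) w = (\<Sum>j\<in>UNIV. if j = i then cnj a * w $ j else 0)"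
    unfolding cinner_def by (intro sum.cong) (auto simp: axis_def)
  then show ?thesis
    by simp
qed

lemma dagger_dagger [simp]: "dagger (dagger A) = A"
  by (simp add: dagger_def vec_eq_iff)

lemma dagger_mult: "dagger (A ** B) = dagger B ** dagger A"
  by (simp add: dagger_def vec_eq_iff matrix_matrix_mult_def mult.commute)

lemma dagger_add: "dagger (A + B) = dagger A + dagger B"
  by (simp add: dagger_def vec_eq_iff)

lemma dagger_zero [simp]: "dagger 0 = 0"
  by (simp add: dagger_def vec_eq_iff)

lemma dagger_sum: "dagger (sum f S) = (\<Sum>k\<in>S. dagger (f k))"
  by (induction S rule: infinite_finite_induct) (auto simp: dagger_add)

lemma cinner_dagger_right: "cinner v (dagger A *v w) = cinner (A *v v) w"
proof -
  have "cinner v (dagger A *v w) = (\<Sum>i\<in>UNIV. \<Sum>j\<in>UNIV. cnj (v $ i) * (cnj (A $ j $ i) * w $ j))"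
    by (simp add: cinner_def dagger_def matrix_vector_mult_def sum_distrib_left)
  also have "\<dots> = (\<Sum>j\<in>UNIV. \<Sum>i\<in>UNIV. cnj (v $ i) * (cnj (A $ j $ i) * w $ j))"
    by (rule sum.swap)
  also have "\<dots> = cinner (A *v v) w"
    by (simp add: cinner_def matrix_vector_mult_def sum_distrib_left mult_ac)
  finally show ?thesis .
qed

lemma matrix_vector_mult_sum_left:
  fixes f :: "'b \<Rightarrow> complex ^ 'n ^ 'm"
  shows "sum f S *v v = (\<Sum>k\<in>S. f k *v v)"
  by (induction S rule: infinite_finite_induct) (auto simp: matrix_vector_mult_add_rdistrib)

lemma matrix_mult_sum_left:
  fixes f :: "'b \<Rightarrow> complex ^ 'n ^ 'm"
  shows "sum f S ** X = (\<Sum>k\<in>S. f k ** X)"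
  by (simp add: vec_eq_iff matrix_matrix_mult_def sum_distrib_right sum.swap[of _ UNIV])

lemma matrix_mult_sum_right:
  fixes f :: "'b \<Rightarrow> complex ^ 'n ^ 'm"
  shows "X ** sum f S = (\<Sum>k\<in>S. X ** f k)"
  by (induction S rule: infinite_finite_induct) (auto simp: matrix_add_ldistrib)

lemma matrix_diff_ldistrib:
  fixes X :: "complex ^ 'n ^ 'm"
  shows "X ** (A - B) = X ** A - X ** B"
  by (simp add: vec_eq_iff matrix_matrix_mult_def sum_subtractf algebra_simps)

lemma trace_sum:
  fixes f :: "'b \<Rightarrow> complex ^ 'n ^ 'n"
  shows "trace (sum f S) = (\<Sum>k\<in>S. trace (f k))"
  by (induction S rule: infinite_finite_induct) (auto simp: trace_add trace_0[simplified])

section \<open>Contractions and the trace functionals they induce\<close>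

text \<open>Operator norm at most 1, phrased through the sesquilinear form: in this shape adjoints
  move to the other argument and the bound can be summed over Kraus operators by
  Cauchy-Schwarz.\<close>

definition contraction :: "complex ^ 'n ^ 'n \<Rightarrow> bool" where
  "contraction X \<longleftrightarrow> (\<forall>v w. norm (cinner w (X *v v)) \<le> norm w * norm v)"

text \<open>Since \<open>P *v v\<close> lies in the subspace and the residual is orthogonal to it,
  the squared norm of \<open>P *v v\<close> is its pairing with \<open>v\<close>; Cauchy-Schwarz
  then allows one factor to be cancelled.\<close>

lemma projector_imp_contraction:
  assumes "projector P"
  shows "contraction P"
  unfolding contraction_def
proof (intro allI)
  fix v w
  have "cinner (P *v v) (v - P *v v) = 0"
    using assms unfolding projector_def by blast
  then have "cinner (P *v v) (P *v v) = cinner (P *v v) v"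
    by (simp add: cinner_diff_right)
  then have "of_real ((norm (P *v v))\<^sup>2) = cinner (P *v v) v"
    by (simp add: cinner_self)
  then have "(norm (P *v v))\<^sup>2 = norm (cinner (P *v v) v)"
    by (metis abs_of_nonneg norm_of_real zero_le_power2)
  also have "\<dots> \<le> norm (P *v v) * norm v"
    by (rule norm_cinner_le)
  finally have "norm (P *v v) \<le> norm v"
    by (cases "P *v v = 0") (simp_all add: power2_eq_square)
  then show "norm (cinner w (P *v v)) \<le> norm w * norm v"
    by (meson mult_left_mono norm_cinner_le norm_ge_zero order_trans)
qed

text \<open>Pairing the \<open>i\<close>-th unit vector with the image of the conjugated row
  \<open>v\<close> gives exactly the squared norm of the row, while \<open>v\<close> itself has the
  norm of the row.\<close>

lemma contraction_norm_row_le: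
  assumes "contraction X"
  shows "norm (X $ i) \<le> 1"
proof -
  define v where "v = (\<chi> j. cnj (X $ i $ j))"
  have nv: "norm v = norm (X $ i)"
    by (simp add: norm_vec_def v_def)
  have "cinner (axis i 1) (X *v v) = (X *v v) $ i"
    by (simp add: cinner_axis_left)
  also have "\<dots> = of_real ((norm (X $ i))\<^sup>2)"
    unfolding norm_vec_sq of_real_sum
    by (simp add: matrix_vector_mult_def v_def flip: complex_norm_square)
  finally have "(norm (X $ i))\<^sup>2 \<le> norm (axis i (1::complex)) * norm v"
    using assms unfolding contraction_def by (metis abs_of_nonneg norm_of_real zero_le_power2)
  then have "(norm (X $ i))\<^sup>2 \<le> norm (X $ i)"
    by (simp add: nv)
  then show ?thesis
    by (cases "norm (X $ i) = 0") (simp_all add: power2_eq_square)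
qed

lemma norm_dagger: "norm (dagger D) = norm D"
proof -
  have "(norm (dagger D))\<^sup>2 = (\<Sum>i\<in>UNIV. \<Sum>j\<in>UNIV. (norm (D $ j $ i))\<^sup>2)"
    by (simp add: norm_vec_sq dagger_def)
  also have "\<dots> = (norm D)\<^sup>2"
    unfolding norm_vec_sq by (rule sum.swap)
  finally show ?thesis
    by simp
qed

text \<open>The trace is a sum over \<open>i\<close> of pairings of rows of \<open>dagger D\<close>
  and \<open>X\<close>. The rows of \<open>X\<close> have norm at most 1, and Cauchy-Schwarz against
  the all-ones vector produces the factor \<open>sqrt (CARD('n))\<close>.\<close>

lemma contraction_trace_bound:
  fixes X D :: "complex ^ 'n ^ 'n"
  assumes "contraction X"
  shows "norm (trace (X ** D)) \<le> sqrt (CARD('n)) * norm D"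
proof -
  have "trace (X ** D) = (\<Sum>i\<in>UNIV. cinner (dagger D $ i) (X $ i))"
    by (simp add: trace_def matrix_matrix_mult_def cinner_def dagger_def mult.commute)
  then have "norm (trace (X ** D)) \<le> (\<Sum>i\<in>UNIV. norm (dagger D $ i) * norm (X $ i))"
    by (auto intro!: order_trans[OF norm_sum] sum_mono norm_cinner_le)
  also have "\<dots> \<le> (\<Sum>i\<in>(UNIV::'n set). \<bar>1\<bar> * \<bar>norm (dagger D $ i)\<bar>)"
    by (intro sum_mono) (use contraction_norm_row_le[OF assms] in \<open>simp add: mult_left_le\<close>)
  also have "\<dots> \<le> L2_set (\<lambda>i. 1) (UNIV::'n set) * L2_set (\<lambda>i. norm (dagger D $ i)) UNIV"
    by (rule L2_set_mult_ineq)
  also have "\<dots> = sqrt (CARD('n)) * norm (dagger D)"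
    by (simp add: L2_set_def norm_vec_def)
  finally show ?thesis
    by (simp add: norm_dagger)
qed

section \<open>Heisenberg duals of quantum operations\<close>

text \<open>The witness is the sum of \<open>dagger (E k) ** X ** E k\<close>, which has the
  required traces by cyclicity. The completeness relation says that the numbers
  \<open>norm (E k *v v)\<close> form a vector of length \<open>norm v\<close>, so Cauchy-Schwarz
  over \<open>k\<close> keeps the dual a contraction.\<close>

lemma quantum_operation_dual:
  fixes \<E> :: "complex ^ 'n ^ 'n \<Rightarrow> complex ^ 'n ^ 'n"
  assumes "quantum_operation \<E>" "contraction X"
  shows "\<exists>Y. contraction Y \<and> (\<forall>\<rho>. trace (X ** \<E> \<rho>) = trace (Y ** \<rho>))"
proof -
  obtain m :: nat and E where E: "\<And>\<rho>. \<E> \<rho> = (\<Sum>k<m. E k ** \<rho> ** dagger (E k))"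
    and I: "(\<Sum>k<m. dagger (E k) ** E k) = mat 1"
    using assms(1) unfolding quantum_operation_def by blast
  define Y where "Y = (\<Sum>k<m. dagger (E k) ** X ** E k)"
  have sq: "(\<Sum>k<m. (norm (E k *v v))\<^sup>2) = (norm v)\<^sup>2" for v
  proof -
    have "(\<Sum>k<m. cinner (E k *v v) (E k *v v)) = cinner v ((\<Sum>k<m. dagger (E k) ** E k) *v v)"
      by (simp add: matrix_vector_mult_sum_left cinner_sum_right cinner_dagger_right
          flip: matrix_vector_mul_assoc)
    then have "(of_real (\<Sum>k<m. (norm (E k *v v))\<^sup>2) :: complex) = of_real ((norm v)\<^sup>2)"
      unfolding I by (simp add: cinner_self)
    then show ?thesis
      unfolding of_real_eq_iff .
  qed
  have "norm (cinner w (Y *v v)) \<le> norm w * norm v" for v w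
  proof -
    have "cinner w (Y *v v) = (\<Sum>k<m. cinner (E k *v w) (X *v (E k *v v)))"
      by (simp add: Y_def matrix_vector_mult_sum_left cinner_sum_right cinner_dagger_right
          flip: matrix_vector_mul_assoc)
    also have "norm \<dots> \<le> (\<Sum>k<m. \<bar>norm (E k *v w)\<bar> * \<bar>norm (E k *v v)\<bar>)"
      using assms(2) unfolding contraction_def
      by (auto intro!: order_trans[OF norm_sum] sum_mono)
    also have "\<dots> \<le> L2_set (\<lambda>k. norm (E k *v w)) {..<m} * L2_set (\<lambda>k. norm (E k *v v)) {..<m}"
      by (rule L2_set_mult_ineq)
    also have "\<dots> = norm w * norm v"
      by (simp add: L2_set_def sq)
    finally show ?thesis .
  qed
  moreover have "trace (X ** \<E> \<rho>) = trace (Y ** \<rho>)" for \<rho>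
  proof -
    have "trace (X ** (E k ** \<rho> ** dagger (E k))) = trace (dagger (E k) ** X ** E k ** \<rho>)" for k
      by (metis matrix_mul_assoc trace_mul_sym)
    then show ?thesis
      by (simp add: E Y_def matrix_mult_sum_left matrix_mult_sum_right trace_sum)
  qed
  ultimately show ?thesis
    unfolding contraction_def by blast
qed

text \<open>\<open>fold\<close> applies the head letter first, so the letters are pulled back onto
  \<open>X\<close> from last to first. One \<open>Y\<close> serves all states, which makes it
  possible to compare two of them.\<close>

lemma fold_quantum_operation_dual:
  assumes "\<forall>a\<in>set z. quantum_operation (\<E> a)" "contraction X"
  shows "\<exists>Y. contraction Y \<and> (\<forall>\<rho>. trace (X ** fold \<E> z \<rho>) = trace (Y ** \<rho>))"
  using assms
proof (induction z)
  case (Cons a z)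
  then obtain Y where "contraction Y" "\<forall>\<rho>. trace (X ** fold \<E> z \<rho>) = trace (Y ** \<rho>)"
    by auto
  with quantum_operation_dual[of "\<E> a" Y] Cons.prems show ?case
    by auto
qed auto

section \<open>Quantum operations preserve density operators\<close>

text \<open>The form of \<open>E k ** \<rho> ** dagger (E k)\<close> at \<open>v\<close> is the form
  of \<open>\<rho>\<close> at \<open>dagger (E k) *v v\<close>, hence nonnegative; the trace is kept
  by cyclicity and the completeness relation.\<close>

lemma quantum_operation_density:
  assumes "quantum_operation \<E>" "density_operator \<rho>"
  shows "density_operator (\<E> \<rho>)"
proof -
  obtain m :: nat and E where E: "\<And>\<rho>. \<E> \<rho> = (\<Sum>k<m. E k ** \<rho> ** dagger (E k))"
    and I: "(\<Sum>k<m. dagger (E k) ** E k) = mat 1"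
    using assms(1) unfolding quantum_operation_def by blast
  have herm: "dagger \<rho> = \<rho>" and pos: "\<And>v. 0 \<le> Re (cinner v (\<rho> *v v))" and tr: "trace \<rho> = 1"
    using assms(2) by (auto simp: density_operator_def pos_semidef_def)
  have "dagger (\<E> \<rho>) = \<E> \<rho>"
    by (simp add: E dagger_sum dagger_mult herm matrix_mul_assoc)
  moreover have "0 \<le> Re (cinner v (\<E> \<rho> *v v))" for v
  proof -
    have "cinner v (\<E> \<rho> *v v) =
        (\<Sum>k<m. cinner v (dagger (dagger (E k)) *v (\<rho> *v (dagger (E k) *v v))))"
      by (simp add: E matrix_vector_mult_sum_left cinner_sum_right flip: matrix_vector_mul_assoc)
    also have "\<dots> = (\<Sum>k<m. cinner (dagger (E k) *v v) (\<rho> *v (dagger (E k) *v v)))"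
      by (simp only: cinner_dagger_right)
    finally show ?thesis
      by (simp add: pos sum_nonneg)
  qed
  moreover have "trace (\<E> \<rho>) = 1"
  proof -
    have "trace (E k ** \<rho> ** dagger (E k)) = trace (dagger (E k) ** E k ** \<rho>)" for k
      by (metis matrix_mul_assoc trace_mul_sym)
    then have "trace (\<E> \<rho>) = trace ((\<Sum>k<m. dagger (E k) ** E k) ** \<rho>)"
      by (simp add: E trace_sum matrix_mult_sum_left)
    then show ?thesis
      by (simp add: I tr)
  qed
  ultimately show ?thesis
    by (simp add: density_operator_def pos_semidef_def)
qed

lemma fold_quantum_operation_density:
  assumes "\<forall>a\<in>set z. quantum_operation (\<E> a)" "density_operator \<rho>"
  shows "density_operator (fold \<E> z \<rho>)"
  using assms by (induction z arbitrary: \<rho>) (auto simp: quantum_operation_density)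

section \<open>Density operators lie in the Frobenius unit ball\<close>

lemma matrix_vector_mult_axis: "(A *v axis i a) $ j = A $ j $ i * (a::complex)"
  by (simp add: matrix_vector_mult_def axis_def if_distrib[of "\<lambda>x. _ * x"] cong: if_cong)

lemma pos_semidef_diag_nonneg:
  assumes "pos_semidef \<rho>"
  shows "0 \<le> Re (\<rho> $ i $ i)"
proof -
  have "cinner (axis i 1) (\<rho> *v axis i 1) = \<rho> $ i $ i"
    by (simp add: cinner_axis_left matrix_vector_mult_axis)
  then show ?thesis
    using assms unfolding pos_semidef_def by metis
qed

text \<open>This is nonnegativity of the 2 by 2 principal minors, obtained from a discriminant
  argument on the span of two unit vectors.\<close>

lemma pos_semidef_entry_le:
  assumes "pos_semidef \<rho>"
  shows "(norm (\<rho> $ i $ j))\<^sup>2 \<le> Re (\<rho> $ i $ i) * Re (\<rho> $ j $ j)"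
proof -
  define z where "z = \<rho> $ i $ j"
  have ji: "\<rho> $ j $ i = cnj z"
    using assms by (simp add: pos_semidef_def dagger_def vec_eq_iff z_def)
  have quad: "0 \<le> (norm z)\<^sup>2 * Re (\<rho> $ i $ i) - 2 * t * (norm z)\<^sup>2 + t\<^sup>2 * Re (\<rho> $ j $ j)"
    for t :: real
  proof -
    \<comment> \<open>With weight \<open>- z\<close> on the \<open>i\<close>-th unit vector, both
      cross terms become minus \<open>t\<close> times the squared modulus of \<open>z\<close>, so
      the form is a real quadratic polynomial in \<open>t\<close>.\<close>
    define v where "v = axis i (- z) + axis j (of_real t)"
    have "cinner v (\<rho> *v v) = cnj z * z * \<rho> $ i $ i - 2 * of_real t * (cnj z * z) +
        of_real t * of_real t * \<rho> $ j $ j"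
      unfolding v_def
      by (simp add: cinner_add_left cinner_add_right cinner_axis_left matrix_vector_mult_axis
          matrix_vector_right_distrib ji algebra_simps flip: z_def)
    also have "cnj z * z = of_real ((norm z)\<^sup>2)"
      by (simp add: complex_norm_square mult.commute del: of_real_power)
    finally have "Re (cinner v (\<rho> *v v)) =
        (norm z)\<^sup>2 * Re (\<rho> $ i $ i) - 2 * t * (norm z)\<^sup>2 + t\<^sup>2 * Re (\<rho> $ j $ j)"
      by (simp add: power2_eq_square)
    then show ?thesis
      using assms unfolding pos_semidef_def by metis
  qed
  show ?thesis
  proof (cases "Re (\<rho> $ j $ j) = 0")
    case True
    \<comment> \<open>The polynomial is now affine in \<open>t\<close>. Any \<open>t\<close> above
      half of the \<open>i\<close>-th diagonal entry makes the factor of the squared modulus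
      negative and so forces \<open>z = 0\<close>.\<close>
    have "(norm z)\<^sup>2 * (2 * (Re (\<rho> $ i $ i) + 1) - Re (\<rho> $ i $ i)) \<le> 0"
      using quad[of "Re (\<rho> $ i $ i) + 1"] by (simp add: True algebra_simps)
    moreover have "0 \<le> Re (\<rho> $ i $ i)"
      by (rule pos_semidef_diag_nonneg[OF assms])
    ultimately have "(norm z)\<^sup>2 \<le> 0"
      by (smt (verit) mult_pos_pos zero_le_power2)
    then show ?thesis
      by (simp add: True z_def)
  next
    case False
    define p q where "p = Re (\<rho> $ i $ i)" and "q = Re (\<rho> $ j $ j)"
    have q: "q > 0"
      using False pos_semidef_diag_nonneg[OF assms, of j] by (simp add: q_def)
    \<comment> \<open>The value of \<open>t\<close> chosen here is the minimiser of the
      polynomial.\<close>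
    have "0 \<le> q * ((norm z)\<^sup>2 * p - 2 * ((norm z)\<^sup>2 / q) * (norm z)\<^sup>2 + ((norm z)\<^sup>2 / q)\<^sup>2 * q)"
      using quad[of "(norm z)\<^sup>2 / q"] q by (simp add: p_def q_def)
    also have "\<dots> = (norm z)\<^sup>2 * (p * q - (norm z)\<^sup>2)"
      using q by (simp add: field_simps power2_eq_square)
    \<comment> \<open>For nonzero \<open>z\<close> the squared modulus is cancelled; for
      \<open>z = 0\<close> the claim is nonnegativity of the diagonal entries.\<close>
    finally have "(norm z)\<^sup>2 \<le> p * q"
      using q pos_semidef_diag_nonneg[OF assms, of i]
      by (cases "z = 0") (auto simp: zero_le_mult_iff p_def)
    then show ?thesis
      by (simp add: z_def p_def q_def)
  qed
qed

text \<open>Summing the minor inequalities over all entries bounds the squared Frobenius norm by the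
  square of the trace.\<close>

lemma density_operator_norm_le:
  assumes "density_operator \<rho>"
  shows "norm \<rho> \<le> 1"
proof -
  have psd: "pos_semidef \<rho>" and tr: "(\<Sum>i\<in>UNIV. Re (\<rho> $ i $ i)) = 1"
    using assms by (auto simp: density_operator_def trace_def simp flip: Re_sum)
  have "(norm \<rho>)\<^sup>2 = (\<Sum>i\<in>UNIV. \<Sum>j\<in>UNIV. (norm (\<rho> $ i $ j))\<^sup>2)"
    by (simp add: norm_vec_sq)
  also have "\<dots> \<le> (\<Sum>i\<in>UNIV. \<Sum>j\<in>UNIV. Re (\<rho> $ i $ i) * Re (\<rho> $ j $ j))"
    by (intro sum_mono pos_semidef_entry_le psd)
  also have "\<dots> = 1"
    by (simp add: tr flip: sum_distrib_left sum_distrib_right)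
  finally show ?thesis
    by (simp add: power_le_one_iff)
qed

section \<open>A volume bound for separated points\<close>

text \<open>The balls of radius \<open>r\<close> around the points are disjoint and lie in the ball
  of radius \<open>1 + r\<close> about 0; in the comparison of volumes the volume of the unit ball
  cancels.\<close>

lemma packing_card_le:
  fixes S :: "'a::euclidean_space set"
  assumes "finite S" "S \<subseteq> cball 0 1" "r > 0"
    and sep: "\<And>x y. \<lbrakk>x \<in> S; y \<in> S; x \<noteq> y\<rbrakk> \<Longrightarrow> 2 * r \<le> dist x y"
  shows "real (card S) \<le> (1 + 1 / r) ^ DIM('a)"
proof -
  let ?c = "unit_ball_vol (DIM('a))"
  have disj: "disjoint_family_on (\<lambda>x. ball x r) S"
    unfolding disjoint_family_on_def
  proof (intro ballI impI)
    fix x y assume "x \<in> S" "y \<in> S" "x \<noteq> y"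
    then have "r + r \<le> dist x y"
      using sep by fastforce
    then show "ball x r \<inter> ball y r = {}"
      by (rule disjoint_ballI)
  qed
  have "real (card S) * (?c * r ^ DIM('a)) = (\<Sum>x\<in>S. measure lborel (ball x r))"
    using \<open>r > 0\<close> by (simp add: content_ball)
  also have "\<dots> = measure lborel (\<Union>x\<in>S. ball x r)"
    using \<open>finite S\<close> disj \<open>r > 0\<close>
    by (intro measure_finite_Union[symmetric]) (auto simp: emeasure_ball)
  also have "\<dots> \<le> measure lborel (ball (0::'a) (1 + r))"
  proof (rule measure_mono_fmeasurable)
    show "(\<Union>x\<in>S. ball x r) \<subseteq> ball 0 (1 + r)"
    proof safe
      fix x y assume "x \<in> S" "y \<in> ball x r"
      then have "norm x \<le> 1" "dist x y < r"
        using assms(2) by auto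
      then show "y \<in> ball 0 (1 + r)"
        using norm_triangle_sub[of y x] by (simp add: dist_norm norm_minus_commute)
    qed
  qed (use \<open>finite S\<close> in \<open>auto intro!: borel_open fmeasurableI emeasure_lborel_ball_finite\<close>)
  also have "\<dots> = ?c * (1 + r) ^ DIM('a)"
    using \<open>r > 0\<close> by (simp add: content_ball)
  finally have "real (card S) * r ^ DIM('a) \<le> (1 + r) ^ DIM('a)"
    by (simp add: mult.left_commute mult_le_cancel_left_pos)
  then have "real (card S) \<le> ((1 + r) / r) ^ DIM('a)"
    using \<open>r > 0\<close> by (simp add: field_simps)
  then show ?thesis
    using \<open>r > 0\<close> by (simp add: add_divide_distrib add.commute)
qed

section \<open>The automaton of left quotients\<close>

text \<open>The Myhill-Nerode residual. Continuations range over words on the alphabet, so a word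
  separating two residuals is one whose letters act by quantum operations.\<close>

definition left_quotient :: "'a set \<Rightarrow> 'a list set \<Rightarrow> 'a list \<Rightarrow> 'a list set" where
  "left_quotient \<Sigma> L x = {z \<in> lists \<Sigma>. x @ z \<in> L}"

text \<open>The next residual depends only on the current one and the letter, which makes the
  transition function well defined.\<close>

lemma left_quotient_snoc:
  assumes "a \<in> \<Sigma>"
  shows "left_quotient \<Sigma> L (x @ [a]) = {z. a # z \<in> left_quotient \<Sigma> L x}"
  using assms by (auto simp: left_quotient_def)

text \<open>The residuals are the states of the minimal automaton; the injection \<open>f\<close>
  renames them to natural numbers.\<close>

lemma dfa_of_left_quotients:
  assumes "finite \<Sigma>" "L \<subseteq> lists \<Sigma>" "finite (left_quotient \<Sigma> L ` lists \<Sigma>)"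
  shows "\<exists>M :: (nat, 'a) dfa. dfa M \<and> dfa_alphabet M = \<Sigma> \<and> dfa_language M = L \<and>
           card (dfa_states M) = card (left_quotient \<Sigma> L ` lists \<Sigma>)"
proof -
  let ?D = "left_quotient \<Sigma> L"
  let ?Q = "?D ` lists \<Sigma>"
  obtain f where "bij_betw f ?Q {0..<card ?Q}"
    using ex_bij_betw_finite_nat[OF assms(3)] by blast
  then have inj: "inj_on f ?Q"
    by (rule bij_betw_imp_inj_on)
  \<comment> \<open>A state is decoded to its residual, differentiated by the letter and encoded
    again. Outside the image of \<open>f\<close> the decoded value is arbitrary, and runs never get
    there.\<close>
  define step where "step q a = f {z. a # z \<in> the_inv_into ?Q f q}" for q a
  define M :: "(nat, 'a) dfa" where
    "M = \<lparr>dfa_states = f ` ?Q, dfa_alphabet = \<Sigma>, dfa_start = f (?D []), dfa_step = step,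
          dfa_final = f ` {q \<in> ?Q. [] \<in> q}\<rparr>"
  have step: "step (f (?D x)) a = f (?D (x @ [a]))" if "x \<in> lists \<Sigma>" "a \<in> \<Sigma>" for x a
    using that inj by (simp add: step_def the_inv_into_f_f left_quotient_snoc)
  \<comment> \<open>The start is any reached residual, so that the induction can absorb letters of
    \<open>x\<close> into \<open>u\<close>.\<close>
  have run: "foldl step (f (?D u)) x = f (?D (u @ x))" if "x \<in> lists \<Sigma>" "u \<in> lists \<Sigma>" for u x
    using that by (induction x arbitrary: u) (auto simp: step)
  have "dfa M"
    unfolding dfa_def
  proof (intro conjI ballI)
    fix q a assume "q \<in> dfa_states M" "a \<in> dfa_alphabet M"
    then obtain x where "x \<in> lists \<Sigma>" "q = f (?D x)" "a \<in> \<Sigma>"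
      by (auto simp: M_def)
    moreover from this have "x @ [a] \<in> lists \<Sigma>"
      by simp
    ultimately show "dfa_step M q a \<in> dfa_states M"
      by (simp add: M_def step del: append_in_lists_conv)
  qed (use assms in \<open>auto simp: M_def\<close>)
  moreover have "dfa_language M = L"
  proof -
    \<comment> \<open>A word lies in the language exactly if its residual contains the empty word;
      injectivity of \<open>f\<close> transfers this to the encoded final states.\<close>
    have "f (?D x) \<in> f ` {q \<in> ?Q. [] \<in> q} \<longleftrightarrow> x \<in> L" if "x \<in> lists \<Sigma>" for x
    proof -
      have "f (?D x) \<in> f ` {q \<in> ?Q. [] \<in> q} \<longleftrightarrow> ?D x \<in> {q \<in> ?Q. [] \<in> q}"
        by (rule inj_on_image_mem_iff[OF inj]) (use that in auto)
      then show ?thesis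
        using that by (auto simp: left_quotient_def)
    qed
    then have "foldl step (f (?D [])) x \<in> f ` {q \<in> ?Q. [] \<in> q} \<longleftrightarrow> x \<in> L" if "x \<in> lists \<Sigma>" for x
      using that by (simp add: run del: in_lists_conv_set)
    then have "dfa_language M = {x \<in> lists \<Sigma>. x \<in> L}"
      by (simp add: dfa_language_def M_def cong: conj_cong del: in_lists_conv_set)
    then show ?thesis
      using assms(2) by blast
  qed
  moreover have "card (dfa_states M) = card ?Q"
    using inj by (simp add: M_def card_image)
  ultimately show ?thesis
    by (intro exI[of _ M]) (simp add: M_def)
qed

section \<open>Isolation separates the reached operators\<close>

lemma isolated_states_separated:
  fixes A :: "('n::finite, 'a) mo1gqfa"
  defines "\<rho> \<equiv> \<lambda>x. fold (letter_op A) x (init_op A)"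
  assumes A: "mo1gqfa A" and rec: "recognizes_isolated A L \<delta>"
    and xy: "x \<in> lists (alphabet A)" "y \<in> lists (alphabet A)"
    and neq: "left_quotient (alphabet A) L x \<noteq> left_quotient (alphabet A) L y"
  shows "2 * (\<delta> / sqrt (CARD('n))) \<le> dist (\<rho> x) (\<rho> y)"
proof -
  \<comment> \<open>The case where the first word is the one accepted after appending
    \<open>z\<close>; the opposite case follows by symmetry of the distance.\<close>
  have sep: "2 * (\<delta> / sqrt (CARD('n))) \<le> dist (\<rho> u) (\<rho> v)"
    if uvz: "u \<in> lists (alphabet A)" "v \<in> lists (alphabet A)" "z \<in> lists (alphabet A)"
      and "u @ z \<in> L" "v @ z \<notin> L" for u v z
  proof -
    obtain c where c: "\<forall>x\<in>L. acc_prob A x > c"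
      "\<forall>x\<in>lists (alphabet A) - L. acc_prob A x \<le> c"
      "\<forall>x\<in>lists (alphabet A). \<bar>acc_prob A x - c\<bar> \<ge> \<delta>"
      using rec unfolding recognizes_isolated_def by blast
    have words: "u @ z \<in> lists (alphabet A)" "v @ z \<in> lists (alphabet A)"
      using uvz by auto
    \<comment> \<open>Membership fixes the side of the cut-point, and isolation strengthens each
      one-sided bound by \<open>\<delta>\<close>.\<close>
    have "acc_prob A (u @ z) \<ge> c + \<delta>" "acc_prob A (v @ z) \<le> c - \<delta>"
      using c that(4,5) words by (smt (verit) DiffI)+
    then have gap: "2 * \<delta> \<le> acc_prob A (u @ z) - acc_prob A (v @ z)"
      by simp
    have "\<forall>a\<in>set z. quantum_operation (letter_op A a)" "contraction (acc_proj A)"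
      using A uvz(3) projector_imp_contraction by (auto simp: mo1gqfa_def)
    from fold_quantum_operation_dual[OF this] obtain Y where Y: "contraction Y"
      "\<And>\<sigma>. trace (acc_proj A ** fold (letter_op A) z \<sigma>) = trace (Y ** \<sigma>)"
      by blast
    have "acc_prob A (u @ z) - acc_prob A (v @ z) = Re (trace (Y ** (\<rho> u - \<rho> v)))"
      by (simp add: acc_prob_def \<rho>_def Y(2) matrix_diff_ldistrib trace_sub)
    also have "\<dots> \<le> sqrt (CARD('n)) * dist (\<rho> u) (\<rho> v)"
      using contraction_trace_bound[OF Y(1), of "\<rho> u - \<rho> v"] complex_Re_le_cmod
      unfolding dist_norm by (rule order_trans[rotated])
    finally have "2 * \<delta> \<le> sqrt (CARD('n)) * dist (\<rho> u) (\<rho> v)"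
      using gap by linarith
    then show ?thesis
      by (simp add: field_simps)
  qed
  from neq obtain z where "z \<in> lists (alphabet A)" "(x @ z \<in> L) \<noteq> (y @ z \<in> L)"
    unfolding left_quotient_def by blast
  then show ?thesis
    using sep[of x y z] sep[of y x z] xy by (auto simp: dist_commute)
qed

section \<open>Counting the residuals\<close>

theorem theorem9:
  fixes A :: "('n::finite, 'a) mo1gqfa" and L :: "'a list set" and \<delta> :: real and n :: nat
  assumes "mo1gqfa A" and "n = CARD('n)"
    and "recognizes_isolated A L \<delta>"
  shows "\<exists>(M :: (nat, 'a) dfa) d. dfa M \<and> dfa_alphabet M = alphabet A \<and> dfa_language M = L \<and>
           card (dfa_states M) = d \<and> real d \<le> (1 + sqrt (real n) / \<delta>) ^ (2 * n\<^sup>2)"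
proof -
  let ?\<Sigma> = "alphabet A"
  let ?D = "left_quotient ?\<Sigma> L"
  let ?Q = "?D ` lists ?\<Sigma>"
  let ?B = "(1 + sqrt (real n) / \<delta>) ^ (2 * n\<^sup>2)"
  define \<rho> where "\<rho> = (\<lambda>x. fold (letter_op A) x (init_op A))"
  \<comment> \<open>Half of the guaranteed separation, so that \<open>1 / r\<close> is the quotient
    in the claimed bound.\<close>
  define r where "r = \<delta> / sqrt n"
  have L: "L \<subseteq> lists ?\<Sigma>" and "\<delta> > 0"
    using assms(3) by (auto simp: recognizes_isolated_def)
  then have "r > 0"
    by (simp add: r_def assms(2))
  \<comment> \<open>Finiteness of \<open>?Q\<close> is not yet known. A uniform bound on the
    cardinality of its finite subsets gives both finiteness and the bound for \<open>?Q\<close>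
    itself.\<close>
  have bound: "card T \<le> nat \<lfloor>?B\<rfloor>" if "T \<subseteq> ?Q" "finite T" for T
  proof -
    \<comment> \<open>One representative word is chosen for each residual in
      \<open>T\<close>.\<close>
    obtain X where X: "X \<subseteq> lists ?\<Sigma>" "inj_on ?D X" "T = ?D ` X"
      using \<open>T \<subseteq> ?Q\<close> by (auto simp: subset_image_inj)
    have sep: "2 * r \<le> dist (\<rho> x) (\<rho> y)" if "x \<in> X" "y \<in> X" "x \<noteq> y" for x y
      unfolding \<rho>_def r_def assms(2)
      by (rule isolated_states_separated[OF assms(1,3)]) (use X that in \<open>auto dest: inj_onD\<close>)
    \<comment> \<open>Positive separation makes distinct representatives reach distinct operators,
      so counting residuals becomes counting points of the unit ball.\<close>
    have "inj_on \<rho> X"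
    proof (rule inj_onI, rule ccontr)
      fix x y assume "x \<in> X" "y \<in> X" "\<rho> x = \<rho> y" "x \<noteq> y"
      with sep[of x y] \<open>r > 0\<close> show False
        by simp
    qed
    then have card: "card T = card (\<rho> ` X)"
      using X by (simp add: card_image)
    have "density_operator (\<rho> x)" if "x \<in> X" for x
      using assms(1) X(1) that unfolding \<rho>_def mo1gqfa_def
      by (intro fold_quantum_operation_density) auto
    then have "\<rho> ` X \<subseteq> cball 0 1"
      by (auto simp: density_operator_norm_le)
    moreover have "finite (\<rho> ` X)"
      using X that(2) finite_image_iff by blast
    ultimately have "real (card (\<rho> ` X)) \<le> (1 + 1 / r) ^ DIM(complex ^ 'n ^ 'n)"
      using sep \<open>r > 0\<close> by (intro packing_card_le) auto
    \<comment> \<open>The exponent is the real dimension of the space of complex matrices.\<close>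
    also have "\<dots> = ?B"
      by (simp add: r_def assms(2) power2_eq_square mult_ac)
    finally show ?thesis
      unfolding card by (simp add: le_nat_floor)
  qed
  then have fin: "finite ?Q" and "card ?Q \<le> nat \<lfloor>?B\<rfloor>"
    using finite_if_finite_subsets_card_bdd[of ?Q "nat \<lfloor>?B\<rfloor>"] by auto
  moreover have "0 \<le> ?B"
    using \<open>\<delta> > 0\<close> by simp
  ultimately have "real (card ?Q) \<le> ?B"
    by (meson of_nat_floor of_nat_mono order_trans)
  moreover have "finite ?\<Sigma>"
    using assms(1) by (simp add: mo1gqfa_def)
  ultimately show ?thesis
    using dfa_of_left_quotients[OF _ L fin] by metis
qed

end
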